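(* Let $p\in\mathcal{H}_1$ and let $\beta$ be a real number. Then each of the following subordinations is sufficient for $p(z)\prec e^z$: (a) $p^2(z)+\beta zp'(z)\prec e^z$, where $\beta\ge e^2+e^{-1}$ $(\approx 7.75694)$; (b) $p^2(z)+\beta\dfrac{zp'(z)}{p(z)}\prec e^z$, where $\beta\ge e+e^{-2}$ $(\approx 2.85362)$; (c) $p^2(z)+\beta\dfrac{zp'(z)}{p^2(z)}\prec e^z$, where $\beta>\beta^*$ and $\beta^*\approx 104.122$ is a positive root (in $x$) of the equation $$6e^6+5xe^3-x^2+(-2e^6-5xe^3+x^2)\ln(e^3+x)=0.$$
   Context: $\mathbb{D}=\{z\in\mathbb{C}:|z|<1\}$. $\mathcal{H}_1$ is the class of analytic functions on $\mathbb{D}$ of the form $p(z)=1+a_1z+a_2z^2+\cdots$. $p^2(z)$ means $(p(z))^2$; $\ln$ is the real natural logarithm. For functions $F,G$ analytic in $\mathbb{D}$, $F\prec G$ (F is subordinate to G) means there is an analytic $w:\mathbb{D}\to\mathbb{C}$ with $w(0)=0$, $|w(z)|<1$ and $F(z)=G(w(z))$ for all $z\in\mathbb{D}$; writing $F\prec G$ presupposes that $F$ and $G$ are analytic in $\mathbb{D}$. *)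

theory Defs
  imports "HOL-Complex_Analysis.Complex_Analysis"
begin

definition H1 :: "(complex \<Rightarrow> complex) set" where
  "H1 = {p. p analytic_on ball 0 1 \<and>
            (\<exists>a :: nat \<Rightarrow> complex. a 0 = 1 \<and> (\<forall>z\<in>ball 0 1. (\<lambda>n. a n * z ^ n) sums p z))}"

text \<open>Only the values on the unit disc matter. Analyticity of both functions is part of the
  relation. In particular a left-hand side containing a quotient with denominator \<open>p z\<close> must be
  analytic on the disc (HOL's \<open>x / 0 = 0\<close> does not remove poles).\<close>

definition subordinate :: "(complex \<Rightarrow> complex) \<Rightarrow> (complex \<Rightarrow> complex) \<Rightarrow> bool" where
  "subordinate F G \<longleftrightarrow>
     F analytic_on ball 0 1 \<and> G analytic_on ball 0 1 \<and>
     (\<exists>w. w analytic_on ball 0 1 \<and> w 0 = 0 \<and>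
          (\<forall>z\<in>ball 0 1. norm (w z) < 1 \<and> F z = G (w z)))"

end

theory Submission
  imports Defs
begin

text \<open>If \<open>p\<close> is not subordinate to \<open>exp\<close>, take a point \<open>z\<close> of minimal modulus at which \<open>p\<close>
  leaves the image of the disc under \<open>exp\<close>. Jack's lemma applied to \<open>Ln \<circ> p\<close> gives
  \<open>p z = exp \<zeta>\<close> and \<open>z * p' z = m * \<zeta> * exp \<zeta>\<close> with \<open>\<bar>\<zeta>\<bar> = 1\<close> and \<open>m \<ge> 1\<close>.
  In each of the three cases the left-hand side then has modulus at least \<open>e\<close> at \<open>z\<close>, whereas
  \<open>exp\<close> has modulus less than \<open>e\<close> on the unit disc. For the third case \<open>\<beta> \<ge> e\<^sup>2 + e\<^sup>3\<close>
  already suffices, so the root near \<open>104.122\<close> only has to be located.\<close>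

section \<open>The first exit from the exponential image of the disc\<close>

text \<open>After rescaling to \<open>f z = w (z0 * z) / w z0\<close>, the map \<open>f\<close>
  sends the unit disc into itself and fixes 0 and 1. The multiplier \<open>m\<close> is then the
  derivative \<open>D\<close> of \<open>f\<close> at 1: Schwarz along the radius gives
  \<open>Re D \<ge> 1\<close>, and maximality along the unit circle makes \<open>D\<close>
  real.\<close>

lemma jack_lemma:
  fixes w :: "complex \<Rightarrow> complex"
  assumes holo: "w holomorphic_on ball 0 (norm z0)" and w0: "w 0 = 0"
    and der: "(w has_field_derivative d) (at z0)"
    and less: "\<And>z. norm z < norm z0 \<Longrightarrow> norm (w z) < norm (w z0)"
    and le: "\<And>z. norm z = norm z0 \<Longrightarrow> norm (w z) \<le> norm (w z0)"
    and z0: "z0 \<noteq> 0"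
  obtains m :: real where "m \<ge> 1" "z0 * d = of_real m * w z0"
proof -
  have wz0: "w z0 \<noteq> 0"
    using less[of 0] z0 by auto
  define f where "f z = w (z0 * z) / w z0" for z
  define D where "D = d * z0 / w z0"
  have f1: "f 1 = 1" using wz0 by (simp add: f_def)
  have derf: "(f has_field_derivative D) (at 1)"
    unfolding f_def D_def
    by (rule DERIV_cdivide, rule DERIV_chain2[where f = w])
       (use der in \<open>auto intro!: derivative_eq_intros\<close>)
  have f_less: "norm (f z) < 1" if "norm z < 1" for z
  proof -
    have "norm (z0 * z) < norm z0"
      using that z0 by (simp add: norm_mult)
    from less[OF this] show ?thesis
      using wz0 by (simp add: f_def norm_divide)
  qed
  have f_le: "norm (f z) \<le> 1" if "norm z = 1" for z
    using le[of "z0 * z"] that wz0 by (simp add: f_def norm_divide norm_mult)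
  have "f holomorphic_on ball 0 1"
  proof -
    have "(w \<circ> (\<lambda>z. z0 * z)) holomorphic_on ball 0 1"
      by (rule holomorphic_on_compose_gen[OF _ holo])
         (use z0 in \<open>auto intro!: holomorphic_intros simp: norm_mult\<close>)
    then show ?thesis
      unfolding f_def o_def using wz0 by (intro holomorphic_intros) auto
  qed
  moreover have "f 0 = 0" by (simp add: f_def w0)
  ultimately have schwarz: "norm (f z) \<le> norm z" if "norm z < 1" for z
    using Schwarz_Lemma(1)[of f z] f_less that by blast
  \<comment> \<open>\<open>g\<close> vanishes at 1. If its derivative there were negative,
    \<open>g\<close> would be positive just to the left of 1, contradicting Re (f t) \<le> t from
    the Schwarz lemma.\<close>
  have "Re D \<ge> 1"
  proof (rule ccontr)
    assume "\<not> Re D \<ge> 1"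
    define g where "g t = Re (f (of_real t)) - t" for t :: real
    have "((\<lambda>t. f (of_real t)) has_vector_derivative D) (at 1)"
      using has_vector_derivative_real_field[of f D 1 UNIV] derf by simp
    then have "((\<lambda>t. Re (f (of_real t))) has_real_derivative Re D) (at 1)"
      by (rule has_field_derivative_Re)
    then have "(g has_real_derivative Re D - 1) (at 1)"
      unfolding g_def by (rule DERIV_diff) (rule DERIV_ident)
    from has_real_derivative_neg_dec_left[OF this]
    obtain \<delta> where "\<delta> > 0" and \<delta>: "\<And>h. h > 0 \<Longrightarrow> h < \<delta> \<Longrightarrow> g 1 < g (1 - h)"
      using \<open>\<not> Re D \<ge> 1\<close> by auto
    define h where "h = min (\<delta>/2) (1/2)"
    have h: "h > 0" "h < \<delta>" "h < 1" using \<open>\<delta> > 0\<close> by (auto simp: h_def min_def)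
    have "Re (f (of_real (1 - h))) \<le> norm (f (of_real (1 - h)))"
      by (rule complex_Re_le_cmod)
    also have "\<dots> \<le> norm (of_real (1 - h) :: complex)"
      by (rule schwarz, subst norm_of_real) (use h in simp)
    also have "\<dots> = 1 - h"
      by (subst norm_of_real) (use h in simp)
    finally have "g (1 - h) \<le> 0" by (simp add: g_def)
    with \<delta>[OF h(1,2)] f1 show False by (simp add: g_def)
  qed
  \<comment> \<open>On the unit circle Re f is at most 1 and attains 1 at the point 1, so the
    tangential derivative \<open>\<i> * D\<close> has real part 0.\<close>
  moreover have "Im D = 0"
  proof -
    define g where "g t = Re (f (cis t))" for t
    have c: "(cis has_vector_derivative \<i>) (at 0)"
      using has_derivative_cis[OF has_derivative_ident, of 0 UNIV]
      by (simp add: has_vector_derivative_def)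
    have "((f \<circ> cis) has_vector_derivative (\<i> * D)) (at 0)"
      by (rule field_vector_diff_chain_at[OF c]) (use derf in simp)
    then have "(g has_real_derivative Re (\<i> * D)) (at 0)"
      unfolding g_def o_def by (rule has_field_derivative_Re)
    then have "Re (\<i> * D) = 0"
    proof (rule DERIV_local_max[OF _ zero_less_one], intro allI impI)
      fix y :: real
      have "g y \<le> 1"
        unfolding g_def using complex_Re_le_cmod[of "f (cis y)"] f_le[of "cis y"] by simp
      then show "g y \<le> g 0" by (simp add: g_def f1)
    qed
    then show ?thesis by simp
  qed
  ultimately have "of_real (Re D) = D" "Re D \<ge> 1"
    by (auto simp: complex_eq_iff)
  moreover have "z0 * d = D * w z0" using wz0 by (simp add: D_def)
  ultimately show ?thesis using that[of "Re D"] by simp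
qed

text \<open>The closed unit disc lies in the strip |Im| < pi, where the principal logarithm inverts
  \<open>exp\<close>. This makes \<open>exp\<close> injective on the disc and keeps its image off
  the branch cut.\<close>

lemma exp_cball_no_nonpos_Reals:
  assumes "norm \<zeta> \<le> 1"
  shows "exp \<zeta> \<notin> \<real>\<^sub>\<le>\<^sub>0" "Ln (exp \<zeta>) = \<zeta>"
proof -
  have "\<bar>Im \<zeta>\<bar> < pi"
    using abs_Im_le_cmod[of \<zeta>] assms pi_gt3 by linarith
  then show L: "Ln (exp \<zeta>) = \<zeta>" by (intro Ln_exp) auto
  show "exp \<zeta> \<notin> \<real>\<^sub>\<le>\<^sub>0"
  proof
    assume "exp \<zeta> \<in> \<real>\<^sub>\<le>\<^sub>0"
    then have "Re (exp \<zeta>) < 0 \<and> Im (exp \<zeta>) = 0"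
      using complex_nonpos_Reals_iff[of "exp \<zeta>"] exp_not_eq_zero[of \<zeta>]
      by (metis complex_eq_iff order_le_less zero_complex.simps)
    then have "Im (Ln (exp \<zeta>)) = pi"
      using Im_Ln_eq_pi[of "exp \<zeta>"] by simp
    with L \<open>\<bar>Im \<zeta>\<bar> < pi\<close> show False by simp
  qed
qed

lemma not_subordinate_exp_first_exit:
  assumes p: "p \<in> H1" and nsub: "\<not> subordinate p exp"
  obtains z \<zeta> m where "norm z < 1" "norm \<zeta> = 1" "m \<ge> (1::real)" "p z = exp \<zeta>"
    "z * deriv p z = of_real m * \<zeta> * exp \<zeta>"
proof -
  from p have an: "p analytic_on ball 0 1" by (simp add: H1_def)
  then have holp: "p holomorphic_on ball 0 1" by (rule analytic_imp_holomorphic)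
  then have contp: "continuous_on (ball 0 1) p" by (rule holomorphic_on_imp_continuous_on)
  from p obtain a :: "nat \<Rightarrow> complex"
    where a: "a 0 = 1" "\<And>z. z \<in> ball 0 1 \<Longrightarrow> (\<lambda>n. a n * z ^ n) sums p z"
    by (auto simp: H1_def)
  have p0: "p 0 = 1"
    using sums_unique2[OF a(2)[of 0] powser_sums_zero[of a]] a(1) by simp
  define E where "E = exp ` ball (0::complex) 1"
  have E_Ln: "x \<notin> \<real>\<^sub>\<le>\<^sub>0 \<and> norm (Ln x) < 1" if "x \<in> E" for x
    using that exp_cball_no_nonpos_Reals unfolding E_def by force
  have opE: "open E"
    unfolding E_def
    by (intro open_mapping_thm3 holomorphic_on_exp open_ball inj_onI)
       (metis exp_cball_no_nonpos_Reals(2) less_imp_le mem_ball_0)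
  \<comment> \<open>If \<open>p\<close> never left \<open>E\<close>, the function Ln p would itself
    witness the subordination.\<close>
  have "\<exists>z\<in>ball 0 1. p z \<notin> E"
  proof (rule ccontr)
    assume "\<not> ?thesis"
    then have all: "p z \<in> E" if "norm z < 1" for z using that by auto
    have "(\<lambda>z. Ln (p z)) holomorphic_on ball 0 1"
      by (intro holomorphic_on_Ln' holp) (use E_Ln all in auto)
    then have an': "(\<lambda>z. Ln (p z)) analytic_on ball 0 1"
      by (simp add: analytic_on_open)
    have "norm (Ln (p z)) < 1 \<and> p z = exp (Ln (p z))" if "z \<in> ball 0 1" for z
      using all[of z] E_Ln[of "p z"] that by (metis exp_Ln mem_ball_0 nonpos_Reals_zero_I)
    with an' have "\<exists>w. w analytic_on ball 0 1 \<and> w 0 = 0 \<and>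
          (\<forall>z\<in>ball 0 1. norm (w z) < 1 \<and> p z = exp (w z))"
      by (intro exI[of _ "\<lambda>z. Ln (p z)"]) (auto simp: p0)
    with nsub an show False
      by (simp add: subordinate_def analytic_on_holomorphic)
         (use holomorphic_on_exp open_UNIV in blast)
  qed
  then obtain b where b: "norm b < 1" "p b \<notin> E" by auto
  \<comment> \<open>Cutting down to the closed disc through the bad point \<open>b\<close> makes the
    set of bad points compact, so one of least modulus exists.\<close>
  define A where "A = {z \<in> cball 0 (norm b). p z \<in> - E}"
  have "closed A"
    unfolding A_def
    by (rule continuous_closed_preimage[unfolded vimage_def Int_def mem_Collect_eq])
       (use opE b in \<open>auto intro!: continuous_on_subset[OF contp]\<close>)
  moreover have "bounded A"
    by (rule bounded_subset[OF bounded_cball[of 0 "norm b"]]) (auto simp: A_def)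
  ultimately have "compact A" by (simp add: compact_eq_bounded_closed)
  then obtain z where z: "z \<in> A" "\<And>y. y \<in> A \<Longrightarrow> norm z \<le> norm y"
    using continuous_attains_inf[of A norm] b by (fastforce simp: A_def intro: continuous_intros)
  have z1: "norm z < 1" and znE: "p z \<notin> E" using z(1) b by (auto simp: A_def)
  have inE: "p y \<in> E" if "norm y < norm z" for y
    using z(2)[of y] z(1) that by (auto simp: A_def)
  have "1 \<in> E" unfolding E_def by (rule image_eqI[of _ _ 0]) auto
  with znE p0 have "z \<noteq> 0" by auto
  have cball: "cball 0 (norm z) \<subseteq> ball (0::complex) 1" using z1 by auto
  \<comment> \<open>Values on the open disc of radius |z| lie in \<open>E\<close>. By continuity
    those on its closure lie in the compact image of the closed unit disc, which pushes \<zeta> onto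
    the unit circle.\<close>
  have "p ` closure (ball 0 (norm z)) \<subseteq> exp ` cball 0 1"
  proof (rule image_closure_subset)
    show "continuous_on (closure (ball 0 (norm z))) p"
      using \<open>z \<noteq> 0\<close> cball by (intro continuous_on_subset[OF contp]) simp
    show "closed (exp ` cball (0::complex) 1)"
      by (intro compact_imp_closed compact_continuous_image continuous_intros) auto
    show "p ` ball 0 (norm z) \<subseteq> exp ` cball 0 1"
      using inE unfolding E_def by fastforce
  qed
  then have in_cball: "p y \<in> exp ` cball 0 1" if "norm y \<le> norm z" for y
    using \<open>z \<noteq> 0\<close> that by auto
  then obtain \<zeta> where \<zeta>: "norm \<zeta> \<le> 1" "p z = exp \<zeta>" by force
  have "norm \<zeta> = 1"
    using znE \<zeta> unfolding E_def by force
  have Lnz: "Ln (p z) = \<zeta>" and pz: "p z \<notin> \<real>\<^sub>\<le>\<^sub>0"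
    using exp_cball_no_nonpos_Reals[OF \<zeta>(1)] \<zeta>(2) by auto
  have "(p has_field_derivative deriv p z) (at z)"
    using holomorphic_derivI[OF holp open_ball] z1 by simp
  then have der: "((\<lambda>z. Ln (p z)) has_field_derivative deriv p z / p z) (at z)"
    using pz by (auto intro!: derivative_eq_intros simp: field_simps)
  obtain m where m: "m \<ge> 1" "z * (deriv p z / p z) = of_real m * Ln (p z)"
  proof (rule jack_lemma[OF _ _ der _ _ \<open>z \<noteq> 0\<close>])
    show "(\<lambda>z. Ln (p z)) holomorphic_on ball 0 (norm z)"
      by (intro holomorphic_on_Ln' holomorphic_on_subset[OF holp])
         (use E_Ln inE z1 in auto)
    show "Ln (p 0) = 0" by (simp add: p0)
    show "norm (Ln (p y)) < norm (Ln (p z))" if "norm y < norm z" for y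
      using E_Ln inE[OF that] Lnz \<open>norm \<zeta> = 1\<close> by simp
    show "norm (Ln (p y)) \<le> norm (Ln (p z))" if "norm y = norm z" for y
      using in_cball[of y] that Lnz \<open>norm \<zeta> = 1\<close> exp_cball_no_nonpos_Reals(2) by force
  qed
  have "z * deriv p z = of_real m * \<zeta> * exp \<zeta>"
    using m(2) Lnz \<zeta>(2) by (simp add: field_simps)
  then show ?thesis
    using that z1 \<open>norm \<zeta> = 1\<close> m(1) \<zeta>(2) by blast
qed

section \<open>The three cases\<close>

text \<open>Reduces each case to an estimate in \<zeta> and \<open>m\<close> alone: subordination of
  \<open>F\<close> forces |F z| = exp (Re u) < e with |u| < 1, also at the exit point.\<close>

lemma subordinate_expI:
  assumes p: "p \<in> H1" and F: "subordinate F exp"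
    and large: "\<And>z \<zeta> m. norm \<zeta> = 1 \<Longrightarrow> m \<ge> (1::real) \<Longrightarrow> p z = exp \<zeta> \<Longrightarrow>
      z * deriv p z = of_real m * \<zeta> * exp \<zeta> \<Longrightarrow> norm (F z) \<ge> exp 1"
  shows "subordinate p exp"
proof (rule ccontr)
  assume "\<not> subordinate p exp"
  from not_subordinate_exp_first_exit[OF p this]
  obtain z \<zeta> m where z: "norm z < 1" and *: "norm \<zeta> = 1" "m \<ge> (1::real)" "p z = exp \<zeta>"
    "z * deriv p z = of_real m * \<zeta> * exp \<zeta>"
    by metis
  from F z obtain u where u: "norm u < 1" "F z = exp u"
    unfolding subordinate_def by fastforce
  have "norm (F z) = exp (Re u)" by (simp add: u norm_exp_eq_Re)
  also have "\<dots> < exp 1" using complex_Re_le_cmod[of u] u(1) by simp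
  finally show False using large[OF *] by simp
qed

lemma norm_exp_bounds_circle:
  assumes "norm (\<zeta>::complex) = 1"
  shows "exp (-1) \<le> norm (exp \<zeta>)" "norm (exp \<zeta>) \<le> exp 1"
  using abs_Re_le_cmod[of \<zeta>] assms by (auto simp: norm_exp_eq_Re abs_le_iff)

lemma norm_add_beta_mult_ge:
  fixes \<zeta> a :: complex
  assumes "norm \<zeta> = 1" "m \<ge> (1::real)" "\<beta> \<ge> (0::real)"
  shows "norm (a + of_real \<beta> * (of_real m * \<zeta>)) \<ge> \<beta> - norm a"
proof -
  have "\<beta> \<le> \<beta> * m" using assms mult_left_mono[of 1 m \<beta>] by simp
  also have "\<dots> = norm (of_real \<beta> * (of_real m * \<zeta>))"
    using assms by (simp add: norm_mult)
  finally show ?thesis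
    using norm_diff_ineq[of "of_real \<beta> * (of_real m * \<zeta>)" a] by (simp add: add.commute)
qed

text \<open>Factoring out \<open>exp \<zeta>\<close> bounds the modulus below by y (\<beta> - y),
  where y = |exp \<zeta>| lies between 1/e and e. The threshold for \<beta> makes this bound equal
  to e at y = 1/e.\<close>

lemma norm_sq_add_deriv_ge:
  fixes \<zeta> :: complex
  assumes \<zeta>: "norm \<zeta> = 1" and m: "m \<ge> (1::real)" and \<beta>: "\<beta> \<ge> exp 2 + exp (-1)"
  shows "norm ((exp \<zeta>)^2 + of_real \<beta> * (of_real m * \<zeta> * exp \<zeta>)) \<ge> exp 1"
proof -
  define y where "y = norm (exp \<zeta>)"
  have y: "exp (-1) \<le> y" "y \<le> exp 1"
    using norm_exp_bounds_circle[OF \<zeta>] by (auto simp: y_def)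
  have "0 \<le> y" by (simp add: y_def)
  have e: "exp (2::real) = exp 1 * exp 1" "exp (-1) * exp (1::real) = 1"
    by (simp_all flip: exp_add)
  \<comment> \<open>With b = e^2 + 1/e, the identity used is y (b - y) - e = (y - 1/e) (e - y) +
    (e^2 - e) (y - 1/e).\<close>
  have "0 \<le> (y - exp (-1)) * (exp 1 - y)" using y by simp
  then have "exp 1 \<le> y * (exp 2 + exp (-1) - y) - (exp 2 - exp 1) * (y - exp (-1))"
    using e by (simp add: algebra_simps)
  also have "\<dots> \<le> y * (exp 2 + exp (-1) - y)" using y by simp
  also have "\<dots> \<le> y * (\<beta> - y)"
    using \<open>0 \<le> y\<close> \<beta> by (intro mult_left_mono) auto
  also have "\<dots> \<le> y * norm (exp \<zeta> + of_real \<beta> * (of_real m * \<zeta>))"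
    using norm_add_beta_mult_ge[OF \<zeta> m, of \<beta> "exp \<zeta>"] order_trans[OF _ \<beta>, of 0] \<open>0 \<le> y\<close>
    by (intro mult_left_mono) (auto simp: y_def)
  also have "\<dots> = norm ((exp \<zeta>)^2 + of_real \<beta> * (of_real m * \<zeta> * exp \<zeta>))"
    unfolding y_def norm_mult[symmetric] by (simp add: power2_eq_square algebra_simps)
  finally show ?thesis .
qed

text \<open>For \<zeta> = -cis t this says that the component of (exp \<zeta>)^2 along \<zeta> is at
  least -exp (-2), with equality at t = 0. Up to pi/3 the angle is at least 2t, and cos 2t \<le> 2
  cos t - 1 \<le> exp (2 cos t - 2); beyond pi/3 the left-hand side is nonpositive.\<close>

lemma cos_add_2_sin_le_exp:
  fixes t :: real
  assumes "\<bar>t\<bar> \<le> pi"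
  shows "cos (t + 2 * sin t) \<le> exp (2 * cos t - 2)"
proof -
  have nonneg: "cos (t + 2 * sin t) \<le> exp (2 * cos t - 2)" if t: "0 \<le> t" "t \<le> pi" for t :: real
  proof (cases "t \<le> pi / 3")
    case True
    have "2 * sin 0 - 0 \<le> 2 * sin t - t"
    proof (rule DERIV_nonneg_imp_nondecreasing[OF t(1)])
      fix x assume "0 \<le> x" "x \<le> t"
      then have "cos (pi / 3) \<le> cos x" using True by (intro cos_monotone_0_pi_le) auto
      then show "\<exists>y. ((\<lambda>x. 2 * sin x - x) has_real_derivative y) (at x) \<and> 0 \<le> y"
        by (intro exI[of _ "2 * cos x - 1"]) (auto intro!: derivative_eq_intros simp: cos_60)
    qed
    moreover have "t + 2 * sin t \<le> pi"
      using True sin_le_one[of t] pi_gt3 by linarith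
    ultimately have "cos (t + 2 * sin t) \<le> cos (2 * t)"
      using t by (intro cos_monotone_0_pi_le) auto
    also have "\<dots> = 2 * (cos t)^2 - 1" by (rule cos_double_cos)
    also have "\<dots> \<le> 2 * cos t - 1"
    proof -
      have "cos (pi / 3) \<le> cos t" using True t by (intro cos_monotone_0_pi_le) auto
      then have "cos t * cos t \<le> 1 * cos t" by (intro mult_right_mono) (auto simp: cos_60)
      then show ?thesis by (simp add: power2_eq_square)
    qed
    also have "\<dots> \<le> exp (2 * cos t - 2)"
      using exp_ge_add_one_self[of "2 * cos t - 2"] by simp
    finally show ?thesis .
  next
    case False
    \<comment> \<open>Up to pi/2, 1/2 \<le> sin t \<le> 1 suffices. Beyond it, sin t = sin (pi - t)
      \<le> pi - t bounds the angle by 2 pi - t.\<close>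
    have "pi / 2 \<le> t + 2 * sin t \<and> t + 2 * sin t \<le> 3 * pi / 2"
    proof (cases "t \<le> pi / 2")
      case True
      have "sin (pi / 6) \<le> sin t"
        using True False by (intro sin_monotone_2pi_le) auto
      then have "2 * sin t \<ge> 1" by (simp add: sin_30)
      with True False sin_le_one[of t] pi_gt3 pi_less_4 show ?thesis by linarith
    next
      case f: False
      have "sin (pi - t) \<le> pi - t" using t by (intro sin_x_le_x) auto
      moreover have "sin t \<ge> 0" using t by (intro sin_ge_zero) auto
      ultimately show ?thesis using f by (auto simp: field_simps)
    qed
    then have "0 \<le> cos (t + 2 * sin t - pi)"
      by (intro cos_ge_zero) auto
    then have "cos (t + 2 * sin t) \<le> 0" by simp
    also have "0 \<le> exp (2 * cos t - 2)" by simp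
    finally show ?thesis .
  qed
  show ?thesis
  proof (cases "t \<ge> 0")
    case True
    then show ?thesis using nonneg assms by auto
  next
    case False
    then have "cos (- t + 2 * sin (- t)) \<le> exp (2 * cos (- t) - 2)"
      using assms by (intro nonneg) auto
    moreover have "cos (- t + 2 * sin (- t)) = cos (t + 2 * sin t)"
      using cos_minus[of "t + 2 * sin t"] by (simp add: algebra_simps)
    ultimately show ?thesis by simp
  qed
qed

lemma norm_sq_add_log_deriv_ge:
  fixes \<zeta> :: complex
  assumes \<zeta>: "norm \<zeta> = 1" and m: "m \<ge> (1::real)" and \<beta>: "\<beta> \<ge> exp 1 + exp (-2)"
  shows "norm ((exp \<zeta>)^2 + of_real \<beta> * (of_real m * \<zeta>)) \<ge> exp 1"
proof -
  \<comment> \<open>Measuring the angle from -1 puts the extremal point \<zeta> = -1 at t =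
    0.\<close>
  define t where "t = Arg (- \<zeta>)"
  have t: "\<bar>t\<bar> \<le> pi" using Arg_bounded[of "- \<zeta>"] by (auto simp: t_def)
  have \<zeta>t: "\<zeta> = - cis t"
    using rcis_cmod_Arg[of "- \<zeta>"] \<zeta> by (simp add: t_def rcis_def minus_equation_iff)
  \<comment> \<open>The modulus is bounded by the component along \<open>\<zeta>\<close>: the triangle inequality alone
    is too weak here when \<open>Re \<zeta>\<close> is close to 1.\<close>
  have "Re ((exp \<zeta>)^2 * cnj \<zeta>) = - (exp (- 2 * cos t) * cos (t + 2 * sin t))"
  proof -
    have "(exp \<zeta>)^2 = exp (2 * \<zeta>)" by (simp add: exp_double)
    then show ?thesis
      by (simp add: \<zeta>t Re_exp Im_exp cos_add algebra_simps)
  qed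
  also have "\<dots> \<ge> - (exp (- 2 * cos t) * exp (2 * cos t - 2))"
    using cos_add_2_sin_le_exp[OF t] by simp
  also have "exp (- 2 * cos t) * exp (2 * cos t - 2) = exp (-2)"
    by (simp flip: exp_add)
  finally have 1: "Re ((exp \<zeta>)^2 * cnj \<zeta>) \<ge> - exp (-2)" .
  have "\<beta> \<ge> 0" using \<beta> by (rule order_trans[rotated]) simp
  then have "\<beta> \<le> \<beta> * m" using m mult_left_mono[of 1 m \<beta>] by simp
  \<comment> \<open>Multiplying by \<open>cnj \<zeta>\<close> preserves the modulus and turns the
    derivative term into the real number \<open>\<beta> * m\<close>.\<close>
  have "\<zeta> * cnj \<zeta> = 1" using complex_norm_square[of \<zeta>] \<zeta> by simp
  then have "((exp \<zeta>)^2 + of_real \<beta> * (of_real m * \<zeta>)) * cnj \<zeta>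
      = (exp \<zeta>)^2 * cnj \<zeta> + of_real (\<beta> * m)"
    by (simp add: distrib_right mult.assoc)
  then have "Re (((exp \<zeta>)^2 + of_real \<beta> * (of_real m * \<zeta>)) * cnj \<zeta>) \<ge> exp 1"
    using 1 \<beta> \<open>\<beta> \<le> \<beta> * m\<close> by simp
  also have "Re (((exp \<zeta>)^2 + of_real \<beta> * (of_real m * \<zeta>)) * cnj \<zeta>)
      \<le> norm (((exp \<zeta>)^2 + of_real \<beta> * (of_real m * \<zeta>)) * cnj \<zeta>)"
    by (rule complex_Re_le_cmod)
  finally show ?thesis using \<zeta> by (simp add: norm_mult)
qed

text \<open>Multiplying by \<open>exp \<zeta>\<close> clears the quotient. The product has modulus
  at least \<beta> - e^3 \<ge> e^2, and the factor has modulus at most e.\<close>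

lemma norm_sq_add_deriv_over_sq_ge:
  fixes \<zeta> :: complex
  assumes \<zeta>: "norm \<zeta> = 1" and m: "m \<ge> (1::real)" and \<beta>: "\<beta> \<ge> exp 2 + exp 3"
  shows "norm ((exp \<zeta>)^2 + of_real \<beta> * (of_real m * \<zeta> * exp \<zeta> / (exp \<zeta>)^2)) \<ge> exp 1"
proof -
  define y where "y = norm (exp \<zeta>)"
  have y: "0 < y" "y \<le> exp 1"
    using norm_exp_bounds_circle[OF \<zeta>] by (auto simp: y_def)
  have "y ^ 3 \<le> exp 1 ^ 3" using y by (intro power_mono) auto
  then have "y ^ 3 \<le> exp 3" by (simp flip: exp_of_nat_mult)
  have "\<beta> \<ge> 0" using \<beta> by (rule order_trans[rotated]) simp
  have "exp 1 * y \<le> exp 1 * exp 1" using y by simp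
  also have "\<dots> = exp 2" by (simp flip: exp_add)
  also have "\<dots> \<le> \<beta> - norm (exp \<zeta> ^ 3)"
    using \<open>y ^ 3 \<le> exp 3\<close> \<beta> by (simp add: y_def norm_power)
  also have "\<dots> \<le> norm (exp \<zeta> ^ 3 + of_real \<beta> * (of_real m * \<zeta>))"
    using \<zeta> m \<open>\<beta> \<ge> 0\<close> by (rule norm_add_beta_mult_ge)
  also have "exp \<zeta> ^ 3 + of_real \<beta> * (of_real m * \<zeta>)
      = ((exp \<zeta>)^2 + of_real \<beta> * (of_real m * \<zeta> * exp \<zeta> / (exp \<zeta>)^2)) * exp \<zeta>"
    by (simp add: field_simps power2_eq_square power3_eq_cube)
  finally show ?thesis using y by (simp add: norm_mult y_def)
qed

section \<open>Location of the root\<close>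

lemma exp_3_bounds: "20.08553 \<le> exp (3::real)" "exp (3::real) \<le> 20.08554"
  and exp_5_bounds: "148.413 \<le> exp (5::real)" "exp (5::real) \<le> 148.4132"
proof -
  have e: "2.71828182 \<le> exp (1::real)" "exp (1::real) \<le> 2.71828183"
    using e_approx_32 by (simp_all add: abs_if split: if_split_asm)
  have pow: "exp (3::real) = exp 1 ^ 3" "exp (5::real) = exp 1 ^ 5"
    by (simp_all flip: exp_of_nat_mult)
  have lo: "2.71828182 ^ n \<le> exp (1::real) ^ n" and hi: "exp (1::real) ^ n \<le> 2.71828183 ^ n" for n
    using e by (auto intro: power_mono)
  show "20.08553 \<le> exp (3::real)" "148.413 \<le> exp (5::real)"
    using lo[of 3] lo[of 5] unfolding pow by (simp_all add: power_divide)
  show "exp (3::real) \<le> 20.08554" "exp (5::real) \<le> 148.4132"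
    using hi[of 3] hi[of 5] unfolding pow by (simp_all add: power_divide)
qed

text \<open>The arguments are near 124.21, a little below e^5, so each logarithm is 5 minus the
  logarithm of a number near 1.195, where a short series is accurate enough.\<close>

lemma ln_bounds_near_root:
  "4.8218 \<le> ln (exp 3 + 104.1215 :: real)" "ln (exp 3 + 104.1225 :: real) \<le> 4.8223"
proof -
  \<comment> \<open>\<open>u\<close> slightly exceeds e^5 / (e^3 + 104.1215), and \<open>v\<close>
    is slightly less than e^5 / (e^3 + 104.1225).\<close>
  define u v :: real where "u = 1.19491" and "v = 1.1948"
  have "ln u \<le> 0.1782"
    using ln_approx_bounds[of u 2] by (simp add: u_def eval_nat_numeral)
  moreover have "ln v \<ge> 0.1777"
    using ln_approx_bounds[of v 2] by (simp add: v_def eval_nat_numeral)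
  moreover have "exp 5 / u \<le> exp 3 + 104.1215" "exp 3 + 104.1225 \<le> exp 5 / v"
    using exp_3_bounds exp_5_bounds by (simp_all add: u_def v_def)
  then have "ln (exp 5 / u) \<le> ln (exp 3 + 104.1215)" "ln (exp 3 + 104.1225) \<le> ln (exp 5 / v)"
    by (subst ln_le_cancel_iff; auto simp: u_def v_def intro: add_pos_pos)+
  moreover have "ln (exp 5 / u) = 5 - ln u" "ln (exp 5 / v) = 5 - ln v"
    by (subst ln_div; simp add: u_def v_def)+
  ultimately show "4.8218 \<le> ln (exp 3 + 104.1215 :: real)" "ln (exp 3 + 104.1225 :: real) \<le> 4.8223"
    by simp_all
qed

text \<open>A sign change between the endpoints 104.122 - 0.0005 and 104.122 + 0.0005 gives the root
  by the intermediate value theorem.\<close>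

lemma root_exists:
  obtains x :: real where "104.1215 < x" "x < 104.1225"
    "6 * exp 6 + 5 * x * exp 3 - x^2 + (- 2 * exp 6 - 5 * x * exp 3 + x^2) * ln (exp 3 + x) = 0"
proof -
  define E :: real where "E = exp 3"
  define F where "F x = 6 * E^2 + 5 * x * E - x^2 + (- 2 * E^2 - 5 * x * E + x^2) * ln (E + x)"
    for x :: real
  have E: "20.08553 \<le> E" "E \<le> 20.08554" using exp_3_bounds by (auto simp: E_def)
  have E2: "403.4285 \<le> E^2" "E^2 \<le> 403.429"
    using power_mono[OF E(1), of 2] power_mono[OF E(2), of 2] E by (simp_all add: power_divide)
  have "F 104.1215 < 0"
  proof -
    \<comment> \<open>\<open>Q\<close> is the coefficient of the logarithm. As it is nonpositive,
      the upper bound for \<open>F\<close> here uses the lower bound for the logarithm; at the right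
      endpoint the roles are exchanged.\<close>
    define Q where "Q = - 2 * E^2 - 5 * 104.1215 * E + 104.1215^2"
    have "Q \<le> 0" using E E2 by (simp add: Q_def power_divide)
    then have "Q * ln (E + 104.1215) \<le> Q * 4.8218"
      using ln_bounds_near_root(1) by (intro mult_left_mono_neg) (auto simp: E_def)
    then show ?thesis
      using E E2 unfolding F_def Q_def by (simp add: power_divide algebra_simps)
  qed
  moreover have "F 104.1225 > 0"
  proof -
    define Q where "Q = - 2 * E^2 - 5 * 104.1225 * E + 104.1225^2"
    have "Q \<le> 0" using E E2 by (simp add: Q_def power_divide)
    then have "Q * ln (E + 104.1225) \<ge> Q * 4.8223"
      using ln_bounds_near_root(2) by (intro mult_left_mono_neg) (auto simp: E_def)
    then show ?thesis
      using E E2 unfolding F_def Q_def by (simp add: power_divide algebra_simps)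
  qed
  moreover have "continuous_on {104.1215..104.1225} F"
    unfolding F_def using E by (intro continuous_intros) auto
  ultimately obtain x where x: "104.1215 \<le> x" "x \<le> 104.1225" "F x = 0"
    using IVT'[of F "104.1215" 0 "104.1225"] by auto
  have "exp (6::real) = E^2" by (simp add: E_def flip: exp_double)
  show ?thesis
  proof (rule that)
    show "104.1215 < x" "x < 104.1225"
      using x \<open>F 104.1215 < 0\<close> \<open>F 104.1225 > 0\<close> by (metis order_less_le)+
    show "6 * exp 6 + 5 * x * exp 3 - x^2
        + (- 2 * exp 6 - 5 * x * exp 3 + x^2) * ln (exp 3 + x) = 0"
      using x(3) unfolding F_def \<open>exp 6 = E^2\<close> by (simp add: E_def)
  qed
qed

theorem theorem4p7:
  shows "(\<forall>p\<in>H1. \<forall>\<beta>::real. \<beta> \<ge> exp 2 + exp (-1) \<longrightarrow>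
            subordinate (\<lambda>z. (p z)^2 + of_real \<beta> * (z * deriv p z)) exp \<longrightarrow> subordinate p exp)
       \<and> (\<forall>p\<in>H1. \<forall>\<beta>::real. \<beta> \<ge> exp 1 + exp (-2) \<longrightarrow>
            subordinate (\<lambda>z. (p z)^2 + of_real \<beta> * (z * deriv p z / p z)) exp \<longrightarrow> subordinate p exp)
       \<and> (\<exists>\<beta>s::real. \<beta>s > 0 \<and>
            6 * exp 6 + 5 * \<beta>s * exp 3 - \<beta>s^2
              + (- 2 * exp 6 - 5 * \<beta>s * exp 3 + \<beta>s^2) * ln (exp 3 + \<beta>s) = 0 \<and>
            \<bar>\<beta>s - 104.122\<bar> < 0.0005 \<and>
            (\<forall>p\<in>H1. \<forall>\<beta>::real. \<beta> > \<beta>s \<longrightarrow>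
              subordinate (\<lambda>z. (p z)^2 + of_real \<beta> * (z * deriv p z / (p z)^2)) exp \<longrightarrow> subordinate p exp))"
proof (intro conjI ballI allI impI)
  fix p and \<beta> :: real
  assume p: "p \<in> H1" and \<beta>: "\<beta> \<ge> exp 2 + exp (-1)"
    and sub: "subordinate (\<lambda>z. (p z)^2 + of_real \<beta> * (z * deriv p z)) exp"
  show "subordinate p exp"
    by (rule subordinate_expI[OF p sub]) (use norm_sq_add_deriv_ge \<beta> in simp)
next
  fix p and \<beta> :: real
  assume p: "p \<in> H1" and \<beta>: "\<beta> \<ge> exp 1 + exp (-2)"
    and sub: "subordinate (\<lambda>z. (p z)^2 + of_real \<beta> * (z * deriv p z / p z)) exp"
  show "subordinate p exp"
    by (rule subordinate_expI[OF p sub]) (use norm_sq_add_log_deriv_ge \<beta> in simp)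
next
  obtain x :: real where x: "104.1215 < x" "x < 104.1225"
    "6 * exp 6 + 5 * x * exp 3 - x^2 + (- 2 * exp 6 - 5 * x * exp 3 + x^2) * ln (exp 3 + x) = 0"
    by (rule root_exists)
  \<comment> \<open>e^2 \<le> e^3 < 21, so e^2 + e^3 < 42, far below the root.\<close>
  have "exp 2 \<le> exp (3::real)" by (subst exp_le_cancel_iff) simp
  moreover have "exp 3 < (21::real)" "42 < x" using exp_3_bounds(2) x(1) by simp_all
  ultimately have x_ge: "exp 2 + exp 3 \<le> x" by linarith
  show "\<exists>\<beta>s::real. \<beta>s > 0 \<and>
            6 * exp 6 + 5 * \<beta>s * exp 3 - \<beta>s^2
              + (- 2 * exp 6 - 5 * \<beta>s * exp 3 + \<beta>s^2) * ln (exp 3 + \<beta>s) = 0 \<and>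
            \<bar>\<beta>s - 104.122\<bar> < 0.0005 \<and>
            (\<forall>p\<in>H1. \<forall>\<beta>::real. \<beta> > \<beta>s \<longrightarrow>
              subordinate (\<lambda>z. (p z)^2 + of_real \<beta> * (z * deriv p z / (p z)^2)) exp \<longrightarrow> subordinate p exp)"
  proof (intro exI[of _ x] conjI ballI allI impI)
    show "x > 0" "\<bar>x - 104.122\<bar> < 0.0005" using x(1,2) by (simp_all add: abs_if)
    fix p and \<beta> :: real
    assume p: "p \<in> H1" and \<beta>: "\<beta> > x"
      and sub: "subordinate (\<lambda>z. (p z)^2 + of_real \<beta> * (z * deriv p z / (p z)^2)) exp"
    show "subordinate p exp"
      by (rule subordinate_expI[OF p sub]) (use norm_sq_add_deriv_over_sq_ge \<beta> x_ge in simp)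
  qed (rule x(3))
qed

end
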